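(* Let $m\ge 1$ be an integer, let $z_0,\dots,z_m\in\mathbb{C}$ be pairwise distinct, let $f_0,\dots,f_m\in\mathbb{C}$, and let $w_0,\dots,w_m\in\mathbb{C}$ all be nonzero. Let $$r(z)=\frac{\sum_{j=0}^m \frac{w_jf_j}{z-z_j}}{\sum_{j=0}^m\frac{w_j}{z-z_j}},\qquad r_j(z)=\frac{\frac{w_j}{z-z_j}}{\sum_{i=0}^m\frac{w_i}{z-z_i}}\quad (j=0,\dots,m).$$ Let $Z_m=\mathrm{diag}(z_0,z_1,\dots,z_m)\in\mathbb{C}^{(m+1)\times(m+1)}$, and let $\underline{W_m}\in\mathbb{C}^{(m+1)\times m}$ be the lower bidiagonal matrix whose $j$-th column ($j=1,\dots,m$) has entry $-w_j$ in row $j$, entry $w_{j-1}$ in row $j+1$, and zeros elsewhere (rows numbered $1,\dots,m+1$). Then, as identities of rational functions in $z$, $$z\,[r_0(z),r_1(z),\dots,r_m(z)]\,\underline{W_m}=[r_0(z),r_1(z),\dots,r_m(z)]\,Z_m\underline{W_m}$$ and $$r(z)=\sum_{j=0}^m f_j r_j(z),$$ and the $(m+1)\times m$ upper-Hessenberg pencil $(Z_m\underline{W_m},\underline{W_m})$ is unreduced. In other words, $r$ has the RKFUN representation $(Z_m\underline{W_m},\underline{W_m},\mathbf{f}_m)$ with $\mathbf{f}_m=[f_0,f_1,\dots,f_m]^T$ and basis functions $r_0,\dots,r_m$.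
   Context: A pair $(\underline{H_m},\underline{K_m})$ of $(m+1)\times m$ upper-Hessenberg matrices is called unreduced if $\underline{H_m}$ and $\underline{K_m}$ have no common zero entries on their subdiagonals, i.e. for each $j=1,\dots,m$ the $(j+1,j)$ entries of $\underline{H_m}$ and $\underline{K_m}$ are not both zero. An RKFUN representation of a rational function $r$ is a triple $(\underline{H_m},\underline{K_m},\mathbf{c}_m)$ consisting of an unreduced upper-Hessenberg pencil $(\underline{H_m},\underline{K_m})$ and a vector $\mathbf{c}_m=[c_0,\dots,c_m]^T\in\mathbb{C}^{m+1}$, together with rational basis functions $r_0,\dots,r_m$ satisfying $z[r_0(z),\dots,r_m(z)]\underline{K_m}=[r_0(z),\dots,r_m(z)]\underline{H_m}$, such that $r(z)=\sum_{j=0}^m c_jr_j(z)$. One basis function (here $r_0$) is regarded as fixed in advance. *)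

theory Defs
  imports
    "Jordan_Normal_Form.Matrix"
    "HOL-Computational_Algebra.Polynomial_Factorial"
begin

text \<open>
  Rational functions in one complex variable are elements of the fraction field of the
  polynomial ring, so that an equation between them is an identity of rational functions
  (no exceptional points).
\<close>

type_synonym ratfun = "complex poly fract"

definition rf_const :: "complex \<Rightarrow> ratfun" where
  "rf_const a = to_fract [:a:]"

definition rf_var :: ratfun where
  "rf_var = to_fract [:0, 1:]"

text \<open>
  Matrix and vector indices start at 0. In particular the subdiagonal entries of an
  \<open>(m+1) \<times> m\<close> matrix are those at \<open>(j + 1, j)\<close> with \<open>j < m\<close>.
\<close>

definition upper_hessenberg :: "'a :: zero mat \<Rightarrow> bool" where
  "upper_hessenberg A \<longleftrightarrow> (\<forall>i < dim_row A. \<forall>j < dim_col A. j + 1 < i \<longrightarrow> A $$ (i, j) = 0)"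

definition unreduced_hessenberg_pencil :: "nat \<Rightarrow> complex mat \<Rightarrow> complex mat \<Rightarrow> bool" where
  "unreduced_hessenberg_pencil m H K \<longleftrightarrow>
     H \<in> carrier_mat (m + 1) m \<and> K \<in> carrier_mat (m + 1) m \<and>
     upper_hessenberg H \<and> upper_hessenberg K \<and>
     (\<forall>j < m. \<not> (H $$ (j + 1, j) = 0 \<and> K $$ (j + 1, j) = 0))"

definition row_mat :: "'a vec \<Rightarrow> 'a mat" where
  "row_mat b = mat_of_rows (dim_vec b) [b]"

definition rkfun_decomposition :: "complex mat \<Rightarrow> complex mat \<Rightarrow> ratfun vec \<Rightarrow> bool" where
  "rkfun_decomposition H K b \<longleftrightarrow>
     (rf_var \<cdot>\<^sub>m row_mat b) * map_mat rf_const K = row_mat b * map_mat rf_const H"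

definition lin_indep_ratfuns :: "ratfun vec \<Rightarrow> bool" where
  "lin_indep_ratfuns b \<longleftrightarrow>
     (\<forall>a \<in> carrier_vec (dim_vec b). map_vec rf_const a \<bullet> b = 0 \<longrightarrow> a = 0\<^sub>v (dim_vec b))"

text \<open>
  \<open>rkfun_representation m H K c b r\<close>: the triple \<open>(H, K, c)\<close> is an RKFUN representation of \<open>r\<close>
  with basis functions \<open>b\<close>. The word basis is taken literally: the entries of \<open>b\<close> are linearly
  independent over the complex numbers.
\<close>

definition rkfun_representation ::
  "nat \<Rightarrow> complex mat \<Rightarrow> complex mat \<Rightarrow> complex vec \<Rightarrow> ratfun vec \<Rightarrow> ratfun \<Rightarrow> bool" where
  "rkfun_representation m H K c b r \<longleftrightarrow>
     unreduced_hessenberg_pencil m H K \<and>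
     c \<in> carrier_vec (m + 1) \<and>
     b \<in> carrier_vec (m + 1) \<and> lin_indep_ratfuns b \<and>
     rkfun_decomposition H K b \<and>
     r = map_vec rf_const c \<bullet> b"

definition bary_denom :: "nat \<Rightarrow> (nat \<Rightarrow> complex) \<Rightarrow> (nat \<Rightarrow> complex) \<Rightarrow> ratfun" where
  "bary_denom m z w = (\<Sum>j\<le>m. rf_const (w j) / (rf_var - rf_const (z j)))"

lemma partial_fractions_indep:
  fixes m k :: nat and z a :: "nat \<Rightarrow> complex"
  assumes z: "inj_on z {..m}"
    and 0: "(\<Sum>j\<le>m. rf_const (a j) / (rf_var - rf_const (z j))) = 0"
    and k: "k \<le> m"
  shows "a k = 0"
proof -
  define L where "L j = [:- z j, 1:]" for j
  have L: "rf_var - rf_const (z j) = to_fract (L j)" for j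
    unfolding rf_var_def rf_const_def L_def by (simp flip: to_fract_diff)
  have nz: "to_fract (L j) \<noteq> 0" for j
    by (simp add: L_def)
  define P where "P j = (\<Prod>i\<in>{..m} - {j}. L i)" for j
  have P: "(\<Prod>i\<le>m. L i) = L j * P j" if "j \<le> m" for j
    unfolding P_def using that by (intro prod.remove) auto
  have hom: "to_fract (\<Sum>j\<le>n. q j) = (\<Sum>j\<le>n. to_fract (q j))"
    for q :: "nat \<Rightarrow> complex poly" and n
    by (induction n) simp_all
  have mult: "to_fract ([:a j:] * P j) = rf_const (a j) * to_fract (P j)" for j
    unfolding rf_const_def by (rule to_fract_mult)
  have "to_fract (\<Sum>j\<le>m. [:a j:] * P j) = (\<Sum>j\<le>m. rf_const (a j) * to_fract (P j))"
    unfolding hom mult ..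
  also have "\<dots> = (\<Sum>j\<le>m. to_fract (\<Prod>i\<le>m. L i) * (rf_const (a j) / to_fract (L j)))"
    by (intro sum.cong refl) (use nz in \<open>simp add: P\<close>)
  also have "\<dots> = 0"
    using 0 unfolding L sum_distrib_left[symmetric] by simp
  finally have "(\<Sum>j\<le>m. [:a j:] * P j) = 0"
    by (simp only: to_fract_eq_0_iff)
  then have "poly (\<Sum>j\<le>m. [:a j:] * P j) (z k) = 0"
    by (simp only: poly_0)
  then have "(\<Sum>j\<le>m. a j * poly (P j) (z k)) = 0"
    by (simp add: poly_sum)
  moreover have "(\<Sum>j\<le>m. a j * poly (P j) (z k)) = (\<Sum>j\<in>{k}. a j * poly (P j) (z k))"
    by (rule sum.mono_neutral_right)
       (use k in \<open>auto simp: P_def L_def poly_prod\<close>)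
  moreover have "poly (P k) (z k) \<noteq> 0"
    using z k by (auto simp: P_def L_def poly_prod inj_on_def)
  ultimately show ?thesis
    by simp
qed

text \<open>The denominator does not vanish, so the convention \<open>x / 0 = 0\<close> plays no role below.\<close>

lemma bary_denom_nonzero:
  assumes "inj_on z {..m}" and "\<forall>j\<le>m. w j \<noteq> 0"
  shows "bary_denom m z w \<noteq> 0"
  using partial_fractions_indep[of z m w 0] assms unfolding bary_denom_def by auto

definition bary_interpolant ::
  "nat \<Rightarrow> (nat \<Rightarrow> complex) \<Rightarrow> (nat \<Rightarrow> complex) \<Rightarrow> (nat \<Rightarrow> complex) \<Rightarrow> ratfun" where
  "bary_interpolant m z w f =
     (\<Sum>j\<le>m. rf_const (w j * f j) / (rf_var - rf_const (z j))) / bary_denom m z w"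

definition bary_basis :: "nat \<Rightarrow> (nat \<Rightarrow> complex) \<Rightarrow> (nat \<Rightarrow> complex) \<Rightarrow> nat \<Rightarrow> ratfun" where
  "bary_basis m z w j = (rf_const (w j) / (rf_var - rf_const (z j))) / bary_denom m z w"

definition bidiag_mat :: "nat \<Rightarrow> (nat \<Rightarrow> complex) \<Rightarrow> complex mat" where
  "bidiag_mat m w = mat (m + 1) m (\<lambda>(i, j).
     if i = j then - w (j + 1) else if i = j + 1 then w j else 0)"

end

theory Submission
  imports Defs
begin

text \<open>
  Multiplying \<open>r\<^sub>j\<close> by \<open>x - z\<^sub>j\<close> leaves \<open>w\<^sub>j / D\<close>, where \<open>D\<close> is the common denominator. Hence
  \<open>w\<^sub>j\<^sub>+\<^sub>1 (x - z\<^sub>j) r\<^sub>j = w\<^sub>j (x - z\<^sub>j\<^sub>+\<^sub>1) r\<^sub>j\<^sub>+\<^sub>1\<close>, and this is column \<open>j\<close> of the decomposition.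
\<close>

lemma rf_const_simps:
  "rf_const 0 = 0" "rf_const (- a) = - rf_const a" "rf_const (a * b) = rf_const a * rf_const b"
proof -
  show "rf_const 0 = 0"
    by (simp add: rf_const_def)
  show "rf_const (- a) = - rf_const a"
    unfolding rf_const_def by (simp flip: to_fract_uminus)
  show "rf_const (a * b) = rf_const a * rf_const b"
    unfolding rf_const_def by (simp flip: to_fract_mult)
qed

lemma rf_var_minus_const_nonzero: "rf_var - rf_const a \<noteq> 0"
  unfolding rf_var_def rf_const_def by (simp flip: to_fract_diff)

text \<open>The linear factor in front cancels the pole term of the basis function. What remains
  depends on \<open>j\<close> only through the weight, which makes neighbouring basis functions
  comparable.\<close>

lemma bary_basis_mult_node:
  "(rf_var - rf_const (z j)) * bary_basis m z w j = rf_const (w j) / bary_denom m z w"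
  using rf_var_minus_const_nonzero[of "z j"] by (simp add: bary_basis_def)

lemma bary_basis_three_term:
  "rf_var * (bary_basis m z w (j + 1) * rf_const (w j) - bary_basis m z w j * rf_const (w (j + 1)))
   = bary_basis m z w (j + 1) * rf_const (z (j + 1) * w j)
     - bary_basis m z w j * rf_const (z j * w (j + 1))"
proof -
  \<comment> \<open>By \<open>bary_basis_mult_node\<close> both sides equal
    \<open>rf_const (w j) * rf_const (w (j + 1)) / bary_denom m z w\<close>.\<close>
  have "rf_const (w (j + 1)) * ((rf_var - rf_const (z j)) * bary_basis m z w j)
      = rf_const (w j) * ((rf_var - rf_const (z (j + 1))) * bary_basis m z w (j + 1))"
    unfolding bary_basis_mult_node by simp
  then show ?thesis
    by (simp add: rf_const_simps algebra_simps)
qed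

lemma sum_bidiagonal:
  fixes g :: "nat \<Rightarrow> 'a :: semiring_0"
  assumes "j < m"
  shows "(\<Sum>i<m + 1. g i * (if i = j then a else if i = j + 1 then b else 0))
    = g j * a + g (j + 1) * b"
proof -
  have "(\<Sum>i<m + 1. g i * (if i = j then a else if i = j + 1 then b else 0))
      = (\<Sum>i\<in>{j, j + 1}. g i * (if i = j then a else if i = j + 1 then b else 0))"
    \<comment> \<open>The bound \<open>j < m\<close> places the subdiagonal row \<open>j + 1\<close>
      inside the summation range.\<close>
    by (rule sum.mono_neutral_right) (use assms in auto)
  then show ?thesis
    by simp
qed

lemma row_mat_mult_index:
  assumes "A \<in> carrier_mat (dim_vec b) n" "j < n"
  shows "(row_mat b * A) $$ (0, j) = (\<Sum>i<dim_vec b. b $ i * A $$ (i, j))"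
  using assms
  by (auto simp: row_mat_def mat_of_rows_def scalar_prod_def atLeast0LessThan intro!: sum.cong)

lemma bidiag_mat_carrier: "bidiag_mat m w \<in> carrier_mat (m + 1) m"
  by (simp add: bidiag_mat_def)

text \<open>A diagonal factor on the left scales row \<open>i\<close> by \<open>z i\<close>, so the
  product is bidiagonal again and both sides of the decomposition can be evaluated by one column
  formula.\<close>

lemma diag_mult_bidiag_mat:
  "mat_diag (m + 1) z * bidiag_mat m w = mat (m + 1) m (\<lambda>(i, j).
     if i = j then - (z j * w (j + 1)) else if i = j + 1 then z (j + 1) * w j else 0)"
  unfolding mat_diag_mult_left[OF bidiag_mat_carrier]
  by (rule eq_matI) (auto simp: bidiag_mat_def)

lemma bary_decomposition:
  fixes z w m
  defines "b \<equiv> vec (m + 1) (bary_basis m z w)"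
  shows "rkfun_decomposition (mat_diag (m + 1) z * bidiag_mat m w) (bidiag_mat m w) b"
  unfolding rkfun_decomposition_def
proof (rule eq_matI)
  let ?W = "bidiag_mat m w" and ?Z = "mat_diag (m + 1) z" and ?r = "bary_basis m z w"
  have dim: "row_mat b \<in> carrier_mat 1 (m + 1)" "?Z * ?W \<in> carrier_mat (m + 1) m"
    "map_mat rf_const ?W \<in> carrier_mat (m + 1) m"
    using bidiag_mat_carrier[of m w]
    by (auto simp: row_mat_def mat_of_rows_def b_def mat_diag_def)
  \<comment> \<open>The entries \<open>p\<close> and \<open>q\<close> stay arbitrary, so that the
    formula applies both to \<open>?W\<close> and to \<open>?Z * ?W\<close>.\<close>
  have col: "(row_mat b * map_mat rf_const (mat (m + 1) m (\<lambda>(i, j).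
       if i = j then p j else if i = j + 1 then q j else 0))) $$ (0, j)
     = ?r j * rf_const (p j) + ?r (j + 1) * rf_const (q j)" if "j < m" for j p q
  proof -
    let ?M = "mat (m + 1) m (\<lambda>(i, j). if i = j then p j else if i = j + 1 then q j else 0)"
    have "(row_mat b * map_mat rf_const ?M) $$ (0, j)
        = (\<Sum>i<m + 1. b $ i * map_mat rf_const ?M $$ (i, j))"
      using that by (subst row_mat_mult_index[where n = m]) (auto simp: b_def)
    also have "\<dots> = (\<Sum>i<m + 1. ?r i *
        (if i = j then rf_const (p j) else if i = j + 1 then rf_const (q j) else 0))"
      using that by (intro sum.cong) (auto simp: b_def rf_const_simps)
    finally show ?thesis
      unfolding sum_bidiagonal[OF that] .
  qed
  show "((rf_var \<cdot>\<^sub>m row_mat b) * map_mat rf_const ?W) $$ (i, j)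
      = (row_mat b * map_mat rf_const (?Z * ?W)) $$ (i, j)"
    if "i < dim_row (row_mat b * map_mat rf_const (?Z * ?W))"
      "j < dim_col (row_mat b * map_mat rf_const (?Z * ?W))" for i j
  proof -
    have i: "i = 0" and j: "j < m"
      using that dim by auto
    have "((rf_var \<cdot>\<^sub>m row_mat b) * map_mat rf_const ?W) $$ (0, j)
        = rf_var * (row_mat b * map_mat rf_const ?W) $$ (0, j)"
      unfolding mult_smult_assoc_mat[OF dim(1,3)] using dim j by simp
    also have "\<dots> = rf_var * (?r (j + 1) * rf_const (w j) - ?r j * rf_const (w (j + 1)))"
      unfolding bidiag_mat_def col[OF j] by (simp add: rf_const_simps)
    also have "\<dots> = ?r (j + 1) * rf_const (z (j + 1) * w j) - ?r j * rf_const (z j * w (j + 1))"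
      by (rule bary_basis_three_term)
    also have "\<dots> = (row_mat b * map_mat rf_const (?Z * ?W)) $$ (0, j)"
      unfolding diag_mult_bidiag_mat col[OF j] by (simp add: rf_const_simps)
    finally show ?thesis
      unfolding i .
  qed
qed (use bidiag_mat_carrier[of m w] in \<open>auto simp: mat_diag_def\<close>)

lemma bary_interpolant_eq_sum:
  "bary_interpolant m z w f = (\<Sum>j\<le>m. rf_const (f j) * bary_basis m z w j)"
  unfolding bary_interpolant_def bary_basis_def sum_divide_distrib
  by (intro sum.cong) (auto simp: rf_const_simps)

text \<open>Reading a linear combination of the basis as the interpolant with data \<open>a\<close>
  serves twice: for the coefficient vector of the representation and for linear
  independence.\<close>

lemma scalar_prod_bary_basis:
  assumes "a \<in> carrier_vec (m + 1)"
  shows "map_vec rf_const a \<bullet> vec (m + 1) (bary_basis m z w)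
    = bary_interpolant m z w (\<lambda>j. a $ j)"
  using assms unfolding bary_interpolant_eq_sum scalar_prod_def
  by (intro sum.cong) auto

text \<open>The denominator is nonzero, so a vanishing combination has vanishing numerator. That
  numerator is a partial fraction sum with distinct poles, which forces every
  \<open>w j * a $ j\<close> to be 0, and the nonzero weights can be divided out.\<close>

lemma lin_indep_bary_basis:
  assumes z: "inj_on z {..m}" and w: "\<forall>j\<le>m. w j \<noteq> 0"
  shows "lin_indep_ratfuns (vec (m + 1) (bary_basis m z w))"
  unfolding lin_indep_ratfuns_def dim_vec
proof (intro ballI impI)
  fix a :: "complex vec"
  assume a: "a \<in> carrier_vec (m + 1)"
    and "map_vec rf_const a \<bullet> vec (m + 1) (bary_basis m z w) = 0"
  then have "(\<Sum>j\<le>m. rf_const (w j * a $ j) / (rf_var - rf_const (z j))) = 0"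
    using bary_denom_nonzero[OF z w] scalar_prod_bary_basis[OF a, of z w]
    by (simp add: bary_interpolant_def)
  from partial_fractions_indep[OF z this] show "a = 0\<^sub>v (m + 1)"
    using a w by (intro eq_vecI) auto
qed

text \<open>The subdiagonal entry of \<open>bidiag_mat m w\<close> in column \<open>j\<close> is the
  nonzero weight \<open>w j\<close>. This one matrix settles the condition even where a node
  \<open>z (j + 1) = 0\<close> makes the entry of the product vanish.\<close>

lemma unreduced_bary_pencil:
  assumes "\<forall>j\<le>m. w j \<noteq> 0"
  shows "unreduced_hessenberg_pencil m (mat_diag (m + 1) z * bidiag_mat m w) (bidiag_mat m w)"
  using assms unfolding unreduced_hessenberg_pencil_def upper_hessenberg_def diag_mult_bidiag_mat
  by (auto simp: bidiag_mat_def)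

theorem mainTheorem1:
  fixes m :: nat and z f w :: "nat \<Rightarrow> complex"
    and Z W :: "complex mat" and b :: "ratfun vec" and r :: ratfun
  assumes "m \<ge> 1"
    and "inj_on z {..m}"
    and "\<forall>j\<le>m. w j \<noteq> 0"
    and "r = bary_interpolant m z w f"
    and "b = vec (m + 1) (bary_basis m z w)"
    and "Z = mat_diag (m + 1) z"
    and "W = bidiag_mat m w"
  shows "(rf_var \<cdot>\<^sub>m row_mat b) * map_mat rf_const W = row_mat b * map_mat rf_const (Z * W) \<and>
    r = (\<Sum>j\<le>m. rf_const (f j) * bary_basis m z w j) \<and>
    unreduced_hessenberg_pencil m (Z * W) W \<and>
    rkfun_representation m (Z * W) W (vec (m + 1) f) b r"
proof -
  have dec: "rkfun_decomposition (Z * W) W b"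
    using assms bary_decomposition by simp
  have unred: "unreduced_hessenberg_pencil m (Z * W) W"
    using assms unreduced_bary_pencil by simp
  have r: "r = (\<Sum>j\<le>m. rf_const (f j) * bary_basis m z w j)"
    using assms bary_interpolant_eq_sum by simp
  have "r = map_vec rf_const (vec (m + 1) f) \<bullet> b"
    \<comment> \<open>The data read off from \<open>vec (m + 1) f\<close> agree with
      \<open>f\<close> at every index \<open>j\<close> \<le> \<open>m\<close>, the whole range of
      the sum.\<close>
    unfolding r assms(5) scalar_prod_bary_basis[OF vec_carrier] bary_interpolant_eq_sum by simp
  then have "rkfun_representation m (Z * W) W (vec (m + 1) f) b r"
    using dec unred assms lin_indep_bary_basis by (simp add: rkfun_representation_def)
  with dec unred r show ?thesis
    by (simp add: rkfun_decomposition_def)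
qed

end
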